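(* The code $C_{D_4}\subset S^3$ consisting of the $24$ normalized roots of the $D_4$ root system (equivalently, the vertices of the regular $24$-cell inscribed in $S^3$) is not universally optimal.
   Context: $S^{n-1}$ denotes the unit sphere in $\mathbb{R}^n$ with the usual inner product $\langle\cdot,\cdot\rangle$. For a function $f\colon[-1,1)\to\mathbb{R}$ and a finite set $C\subset S^{n-1}$, the energy is $$E_f(C)=\sum_{c,c'\in C,\ c\neq c'} f\big(\langle c,c'\rangle\big),$$ the sum being over ordered pairs of distinct points. A function $f\colon[-1,1)\to\mathbb{R}$ is absolutely monotonic if it is smooth and $f$ and all its derivatives are nonnegative on $[-1,1)$. A finite subset $C_0\subset S^{n-1}$ is universally optimal if $E_f(C_0)\le E_f(C)$ for every $C\subset S^{n-1}$ with $\#C=\#C_0$ and every absolutely monotonic $f$. In coordinates, up to an orthogonal transformation, $C_{D_4}=\{(\pm e_i\pm e_j)/\sqrt{2} : 1\le i<j\le 4\}\subset S^3$ (all choices of signs), where $e_1,\dots,e_4$ is the standard basis of $\mathbb{R}^4$. *)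

theory Defs
  imports "HOL-Analysis.Analysis"
begin

definition energy :: "(real \<Rightarrow> real) \<Rightarrow> 'a::euclidean_space set \<Rightarrow> real" where
  "energy f C = (\<Sum>c\<in>C. \<Sum>c'\<in>C - {c}. f (c \<bullet> c'))"

text \<open>
  A function on \<open>[-1,1)\<close> is represented by a total function whose values outside \<open>[-1,1)\<close> play no
  role. Derivatives are taken within \<open>[-1,1)\<close>, hence are one-sided at \<open>-1\<close>. As no point of
  \<open>[-1,1)\<close> is isolated, \<open>F k\<close> is determined there as the \<open>k\<close>-th derivative of \<open>f\<close>.
\<close>

definition absolutely_monotonic :: "(real \<Rightarrow> real) \<Rightarrow> bool" where
  "absolutely_monotonic f \<longleftrightarrow>
     (\<exists>F :: nat \<Rightarrow> real \<Rightarrow> real.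
        (\<forall>x\<in>{-1..<1}. F 0 x = f x) \<and>
        (\<forall>k. \<forall>x\<in>{-1..<1}. (F k has_real_derivative F (Suc k) x) (at x within {-1..<1})) \<and>
        (\<forall>k. \<forall>x\<in>{-1..<1}. 0 \<le> F k x))"

definition universally_optimal :: "'a::euclidean_space set \<Rightarrow> bool" where
  "universally_optimal C\<^sub>0 \<longleftrightarrow>
     finite C\<^sub>0 \<and> C\<^sub>0 \<subseteq> sphere 0 1 \<and>
     (\<forall>(C :: 'a set) f. finite C \<longrightarrow> C \<subseteq> sphere 0 1 \<longrightarrow> card C = card C\<^sub>0 \<longrightarrow> absolutely_monotonic f \<longrightarrow>
        energy f C\<^sub>0 \<le> energy f C)"

text \<open>
  Exchanging the two summands shows that \<open>i \<noteq> j\<close> gives the same set as \<open>i < j\<close>.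
\<close>

definition D4_code :: "(real ^ 4) set" where
  "D4_code = {(1 / sqrt 2) *\<^sub>R (s *\<^sub>R axis i 1 + t *\<^sub>R axis j 1) | i j s t.
                i \<noteq> j \<and> s \<in> {-1, 1} \<and> t \<in> {-1, 1}}"

lemma D4_code_subset_sphere: "D4_code \<subseteq> sphere 0 1"
proof
  fix x assume "x \<in> D4_code"
  then obtain i j :: 4 and s t :: real where x: "x = (1 / sqrt 2) *\<^sub>R (s *\<^sub>R axis i 1 + t *\<^sub>R axis j 1)"
    and ij: "i \<noteq> j" and st: "s \<in> {-1, 1}" "t \<in> {-1, 1}"
    unfolding D4_code_def by blast
  have "x \<bullet> x = 1"
    using ij st unfolding x
    by (auto simp: inner_add_left inner_add_right inner_diff_left inner_diff_right inner_axis_axis field_simps)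
  then show "x \<in> sphere 0 1" by (simp add: norm_eq_1)
qed

lemma card_D4_code: "card D4_code = 24"
proof -
  define P :: "(int \<times> int \<times> int \<times> int) set" where
    "P = Set.filter (\<lambda>(a, b, c, d). \<bar>a\<bar> + \<bar>b\<bar> + \<bar>c\<bar> + \<bar>d\<bar> = 2)
           ({-1, 0, 1} \<times> {-1, 0, 1} \<times> {-1, 0, 1} \<times> {-1, 0, 1})"
  define v :: "int \<times> int \<times> int \<times> int \<Rightarrow> real ^ 4" where
    "v = (\<lambda>(a, b, c, d). (1 / sqrt 2) *\<^sub>R
           (\<chi> k. of_int (if k = 1 then a else if k = 2 then b else if k = 3 then c else d)))"
  have "D4_code \<subseteq> v ` P"
  proof
    fix x assume "x \<in> D4_code"
    then obtain i j :: 4 and s t :: real where x: "x = (1 / sqrt 2) *\<^sub>R (s *\<^sub>R axis i 1 + t *\<^sub>R axis j 1)"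
      and ij: "i \<noteq> j" and st: "s \<in> {-1, 1}" "t \<in> {-1, 1}"
      unfolding D4_code_def by blast
    define q where "q = (\<lambda>k. (if k = i then (if s = 1 then 1 else -1) else 0) +
                             (if k = j then (if t = 1 then 1 else -1) else 0 :: int))"
    have "x = v (q 1, q 2, q 3, q 4)"
      using ij st unfolding x v_def q_def
      by (auto simp: vec_eq_iff forall_4 axis_def)
    moreover have "(q 1, q 2, q 3, q 4) \<in> P"
      using exhaust_4[of i] exhaust_4[of j]
      by (elim disjE) (use ij in \<open>simp_all add: P_def q_def\<close>)
    ultimately show "x \<in> v ` P" by blast
  qed
  moreover have "v ` P \<subseteq> D4_code"
  proof
    have mem: "x \<in> D4_code"
      if "x = (1 / sqrt 2) *\<^sub>R (s *\<^sub>R axis i 1 + t *\<^sub>R axis j 1)" "i \<noteq> j" "s \<in> {-1, 1}" "t \<in> {-1, 1}"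
      for x :: "real ^ 4" and i j s t
      using that unfolding D4_code_def by blast
    fix x assume "x \<in> v ` P"
    then obtain a b c d where x: "x = v (a, b, c, d)" and p: "(a, b, c, d) \<in> P" by auto
    have r: "a \<in> {-1, 0, 1}" "b \<in> {-1, 0, 1}" "c \<in> {-1, 0, 1}" "d \<in> {-1, 0, 1}"
      and s: "\<bar>a\<bar> + \<bar>b\<bar> + \<bar>c\<bar> + \<bar>d\<bar> = 2"
      using p unfolding P_def by auto
    consider "c = 0" "d = 0" "a \<noteq> 0" "b \<noteq> 0" | "b = 0" "d = 0" "a \<noteq> 0" "c \<noteq> 0"
      | "b = 0" "c = 0" "a \<noteq> 0" "d \<noteq> 0" | "a = 0" "d = 0" "b \<noteq> 0" "c \<noteq> 0"
      | "a = 0" "c = 0" "b \<noteq> 0" "d \<noteq> 0" | "a = 0" "b = 0" "c \<noteq> 0" "d \<noteq> 0"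
      using r s by auto
    then show "x \<in> D4_code"
    proof cases
      case 1 then show ?thesis using r
        by (intro mem[of x "of_int a" 1 "of_int b" 2])
           (auto simp: x v_def vec_eq_iff forall_4 axis_def)
    next
      case 2 then show ?thesis using r
        by (intro mem[of x "of_int a" 1 "of_int c" 3])
           (auto simp: x v_def vec_eq_iff forall_4 axis_def)
    next
      case 3 then show ?thesis using r
        by (intro mem[of x "of_int a" 1 "of_int d" 4])
           (auto simp: x v_def vec_eq_iff forall_4 axis_def)
    next
      case 4 then show ?thesis using r
        by (intro mem[of x "of_int b" 2 "of_int c" 3])
           (auto simp: x v_def vec_eq_iff forall_4 axis_def)
    next
      case 5 then show ?thesis using r
        by (intro mem[of x "of_int b" 2 "of_int d" 4])
           (auto simp: x v_def vec_eq_iff forall_4 axis_def)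
    next
      case 6 then show ?thesis using r
        by (intro mem[of x "of_int c" 3 "of_int d" 4])
           (auto simp: x v_def vec_eq_iff forall_4 axis_def)
    qed
  qed
  ultimately have "D4_code = v ` P" by blast
  moreover have "inj_on v P"
    by (auto simp: inj_on_def v_def vec_eq_iff forall_4)
  moreover have "card P = 24" unfolding P_def by code_simp
  ultimately show ?thesis by (metis card_image)
qed

end

theory Submission
  imports Defs
begin

text \<open>
  For the potential \<open>f(t) = (1 + t)^10\<close> the \<open>D\<^sub>4\<close> code is beaten by an explicit code of
  24 points. Identify \<open>real ^ 4\<close> with pairs of complex numbers, let \<open>u\<close> and \<open>w\<close> run over the
  three cube roots of unity, and take real \<open>c\<close>, \<open>s\<close> with \<open>c\<^sup>2 + s\<^sup>2 = 1\<close>. The points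
  \<open>(u, 0)\<close>, \<open>(0, w)\<close>, \<open>(-c u, s w)\<close>, \<open>(s u, -c w)\<close> number \<open>3 + 3 + 9 + 9 = 24\<close>. Their inner
  products are combinations of \<open>c\<close>, \<open>s\<close> and the real parts \<open>1\<close>, \<open>-1/2\<close> of cube roots of unity.

  Heuristically, the gain comes from the close pairs. Among the 552 ordered pairs of the \<open>D\<^sub>4\<close> code,
  192 have inner product exactly \<open>1/2\<close>. For \<open>c\<close> near \<open>0.82\<close> the competing code has only
  72 ordered pairs above \<open>1/2\<close>, at inner products \<open>s\<close> and \<open>c\<^sup>2 - s\<^sup>2/2\<close>, both below \<open>0.6\<close>; its other
  fairly close pairs, at \<open>c s\<close> and \<open>c/2\<close>, lie strictly below \<open>1/2\<close>. A potential that
  is too flat does not reward this, and one that is too steep sees only the largest inner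
  product, where \<open>D\<^sub>4\<close> wins; degree 10 lies between. The energy as a function
  of \<open>c\<close> is smallest near \<open>0.822\<close>. The choice \<open>c = 153/185\<close>, \<open>s = 104/185\<close> comes
  from the Pythagorean triple \<open>104\<^sup>2 + 153\<^sup>2 = 185\<^sup>2\<close> and makes all inner products rational.

  Both Gram matrices then have a common denominator, 2 and \<open>2 * 185\<^sup>2 = 68450\<close> respectively, and
  lemma \<open>integer_gram\<close> turns each energy into a sum of integer powers. Evaluating these sums
  gives \<open>11215.875\<close> for \<open>D\<^sub>4\<close> (lemma \<open>energy_D4\<close>) and about \<open>11203.5\<close> for the competitor
  (lemma \<open>mu3_sum\<close>), while \<open>f\<close> is absolutely monotonic by
  \<open>absolutely_monotonic_power\<close>.
\<close>

text \<open>
  Everything that matters about a code is its Gram matrix. When that matrix has a common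
  denominator \<open>N\<close>, unit norm and distinctness of the points and the energy all become statements
  about integers. The assumption \<open>unit\<close> encodes two of them at once: a diagonal entry is
  1, and an off-diagonal entry is not, so that different indices give different points.
\<close>

lemma integer_gram:
  fixes v :: "'b \<Rightarrow> 'a::euclidean_space" and g :: "'b \<Rightarrow> 'b \<Rightarrow> int" and N :: int
  assumes "distinct xs" and "N > 0"
    and gram: "\<And>x y. x \<in> set xs \<Longrightarrow> y \<in> set xs \<Longrightarrow> v x \<bullet> v y = of_int (g x y) / of_int N"
    and unit: "\<forall>x\<in>set xs. \<forall>y\<in>set xs. g x y = N \<longleftrightarrow> x = y"
  shows "v ` set xs \<subseteq> sphere 0 1" (is ?sphere)
    and "card (v ` set xs) = length xs" (is ?card)
    and "energy (\<lambda>t. (1 + t) ^ k) (v ` set xs) =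
           of_int (\<Sum>x\<leftarrow>xs. \<Sum>y\<leftarrow>xs. if x = y then 0 else (N + g x y) ^ k) / of_int N ^ k" (is ?energy)
proof -
  have inj: "inj_on v (set xs)"
  proof (rule inj_onI)
    fix x y assume xy: "x \<in> set xs" "y \<in> set xs" and "v x = v y"
    then have "real_of_int (g x y) / of_int N = of_int (g x x) / of_int N"
      using gram by metis
    then have "g x y = g x x" using \<open>N > 0\<close> by simp
    then show "x = y" using unit xy by metis
  qed
  show ?sphere
  proof
    fix z assume "z \<in> v ` set xs"
    then obtain x where x: "x \<in> set xs" "z = v x" by blast
    moreover have "g x x = N" using unit x by blast
    ultimately have "z \<bullet> z = 1" using gram[of x x] \<open>N > 0\<close> by simp
    then show "z \<in> sphere 0 1" by (simp add: norm_eq_1)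
  qed
  show ?card using inj \<open>distinct xs\<close> by (simp add: card_image distinct_card)
  have "energy (\<lambda>t. (1 + t) ^ k) (v ` set xs) =
        (\<Sum>x\<in>set xs. \<Sum>y\<in>set xs - {x}. (1 + v x \<bullet> v y) ^ k)"
    unfolding energy_def
  proof (subst sum.reindex[OF inj], rule sum.cong[OF refl])
    fix x assume x: "x \<in> set xs"
    have "v ` set xs - {v x} = v ` (set xs - {x})"
      using inj x by (auto simp: inj_on_def)
    moreover have "inj_on v (set xs - {x})" using inj by (rule inj_on_subset) auto
    ultimately show "((\<lambda>c. \<Sum>c'\<in>v ` set xs - {c}. (1 + c \<bullet> c') ^ k) \<circ> v) x =
        (\<Sum>y\<in>set xs - {x}. (1 + v x \<bullet> v y) ^ k)"
      by (simp add: sum.reindex)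
  qed
  also have "\<dots> = (\<Sum>x\<in>set xs. \<Sum>y\<in>set xs. of_int (if x = y then 0 else (N + g x y) ^ k) / of_int N ^ k)"
  proof (rule sum.cong[OF refl])
    fix x assume x: "x \<in> set xs"
    have "(\<Sum>y\<in>set xs - {x}. (1 + v x \<bullet> v y) ^ k) =
          (\<Sum>y\<in>set xs - {x}. of_int (if x = y then 0 else (N + g x y) ^ k) / of_int N ^ k)"
    proof (rule sum.cong[OF refl])
      fix y assume y: "y \<in> set xs - {x}"
      then have "1 + v x \<bullet> v y = of_int (N + g x y) / of_int N"
        using gram[of x y] x \<open>N > 0\<close> by (simp add: field_simps)
      then show "(1 + v x \<bullet> v y) ^ k = of_int (if x = y then 0 else (N + g x y) ^ k) / of_int N ^ k"
        using y by (auto simp: power_divide)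
    qed
    also have "\<dots> = (\<Sum>y\<in>set xs. of_int (if x = y then 0 else (N + g x y) ^ k) / of_int N ^ k)"
      by (rule sum.mono_neutral_left) auto
    finally show "(\<Sum>y\<in>set xs - {x}. (1 + v x \<bullet> v y) ^ k) = \<dots>" .
  qed
  also have "\<dots> = of_int (\<Sum>x\<in>set xs. \<Sum>y\<in>set xs. if x = y then 0 else (N + g x y) ^ k) / of_int N ^ k"
    by (simp add: sum_divide_distrib)
  also have "(\<Sum>x\<in>set xs. \<Sum>y\<in>set xs. if x = y then 0 else (N + g x y) ^ k) =
      (\<Sum>x\<leftarrow>xs. \<Sum>y\<leftarrow>xs. if x = y then 0 else (N + g x y) ^ k)"
    using \<open>distinct xs\<close> by (simp add: sum.distinct_set_conv_list)
  finally show ?energy .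
qed

lemma absolutely_monotonic_power: "absolutely_monotonic (\<lambda>t. (1 + t) ^ k)"
  unfolding absolutely_monotonic_def
proof (intro exI conjI allI ballI)
  \<comment> \<open>For \<open>m > k\<close> the product contains the factor \<open>i = k\<close>, so truncated subtraction does no harm.\<close>
  define F where "F = (\<lambda>m t. (\<Prod>i<m. real (k - i)) * (1 + t) ^ (k - m))"
  fix m and x :: real assume x: "x \<in> {-1..<1}"
  show "F 0 x = (1 + x) ^ k" by (simp add: F_def)
  show "(F m has_real_derivative F (Suc m) x) (at x within {-1..<1})"
    unfolding F_def by (auto intro!: derivative_eq_intros simp: mult_ac)
  show "0 \<le> F m x"
    using x by (auto simp: F_def intro!: mult_nonneg_nonneg prod_nonneg)
qed

lemma vector_4:
  "(vector [a, b, c, d] :: 'a::zero ^ 4) $ 1 = a" "(vector [a, b, c, d] :: 'a ^ 4) $ 2 = b"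
  "(vector [a, b, c, d] :: 'a ^ 4) $ 3 = c" "(vector [a, b, c, d] :: 'a ^ 4) $ 4 = d"
  by (simp_all add: vector_def)

definition D4_point :: "int \<times> int \<times> int \<times> int \<Rightarrow> real ^ 4" where
  "D4_point = (\<lambda>(a, b, c, d). (1 / sqrt 2) *\<^sub>R vector [of_int a, of_int b, of_int c, of_int d])"

text \<open>Twice the inner product, so that the entries are integers and the diagonal is 2.\<close>

definition D4_gram :: "int \<times> int \<times> int \<times> int \<Rightarrow> int \<times> int \<times> int \<times> int \<Rightarrow> int" where
  "D4_gram = (\<lambda>(a, b, c, d) (a', b', c', d'). a * a' + b * b' + c * c' + d * d')"

definition D4_list :: "(int \<times> int \<times> int \<times> int) list" where
  "D4_list = [(a, b, c, d). a \<leftarrow> [-1, 0, 1], b \<leftarrow> [-1, 0, 1], c \<leftarrow> [-1, 0, 1], d \<leftarrow> [-1, 0, 1],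
                            a\<^sup>2 + b\<^sup>2 + c\<^sup>2 + d\<^sup>2 = 2]"

lemma D4_inner: "D4_point x \<bullet> D4_point y = of_int (D4_gram x y) / of_int 2"
  by (auto simp: D4_point_def D4_gram_def inner_vec_def sum_4 vector_4 field_simps
      split: prod.splits)

lemma D4_list_distinct: "distinct D4_list"
  by code_simp

lemma D4_list_unit: "\<forall>x\<in>set D4_list. \<forall>y\<in>set D4_list. D4_gram x y = 2 \<longleftrightarrow> x = y"
  by code_simp

lemma D4_sum:
  "(\<Sum>x\<leftarrow>D4_list. \<Sum>y\<leftarrow>D4_list. if x = y then 0 else (2 + D4_gram x y) ^ 10) = 11485056"
  by code_simp

lemma D4_list_length: "length D4_list = 24"
  by code_simp

text \<open>
  One inclusion is enough, because both sides have 24 elements: the left one by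
  \<open>card_D4_code\<close>, the right one because its Gram matrix separates the indices.
\<close>

lemma D4_code_eq: "D4_code = D4_point ` set D4_list"
proof -
  have "D4_code \<subseteq> D4_point ` set D4_list"
  proof
    fix x assume "x \<in> D4_code"
    then obtain i j :: 4 and s t :: real
      where x: "x = (1 / sqrt 2) *\<^sub>R (s *\<^sub>R axis i 1 + t *\<^sub>R axis j 1)"
        and "i \<noteq> j" and "s \<in> {-1, 1}" "t \<in> {-1, 1}"
      unfolding D4_code_def by blast
    then obtain m n :: int where mn: "s = of_int m" "t = of_int n" "m \<in> {-1, 1}" "n \<in> {-1, 1}"
      by (metis insert_iff of_int_1 of_int_minus singletonD)
    define q where "q = (\<lambda>k. if k = i then m else if k = j then n else 0)"
    have "x = D4_point (q 1, q 2, q 3, q 4)"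
      using \<open>i \<noteq> j\<close> by (auto simp: x mn(1,2) D4_point_def q_def vec_eq_iff forall_4 axis_def vector_4)
    moreover have "(q 1, q 2, q 3, q 4) \<in> set D4_list"
      using exhaust_4[of i] exhaust_4[of j] mn(3,4)
      by (elim disjE) (use \<open>i \<noteq> j\<close> in \<open>auto simp: D4_list_def q_def\<close>)
    ultimately show "x \<in> D4_point ` set D4_list" by blast
  qed
  moreover have "card (D4_point ` set D4_list) = 24"
    using integer_gram(2)[of D4_list 2 D4_point D4_gram, OF D4_list_distinct _ D4_inner D4_list_unit]
    by (simp add: D4_list_length)
  ultimately show ?thesis by (simp add: card_D4_code card_subset_eq)
qed

lemma energy_D4: "energy (\<lambda>t. (1 + t) ^ 10) D4_code = 11215.875"
  unfolding D4_code_eq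
  using integer_gram(3)[of D4_list 2 D4_point D4_gram 10, OF D4_list_distinct _ D4_inner D4_list_unit]
  by (simp add: D4_sum)

text \<open>
  The tuple \<open>(p, i, q, j)\<close> stands for the pair of complex numbers \<open>(p u\<^sup>i, q u\<^sup>j) / 185\<close> with
  \<open>u = exp(2 \<pi> \<i> / 3)\<close>.
\<close>

definition mu3_point :: "int \<times> nat \<times> int \<times> nat \<Rightarrow> real ^ 4" where
  "mu3_point = (\<lambda>(p, i, q, j). (1 / 185) *\<^sub>R
     vector [p * cos (2 * pi * i / 3), p * sin (2 * pi * i / 3),
             q * cos (2 * pi * j / 3), q * sin (2 * pi * j / 3)])"

text \<open>
  Scaling by \<open>2 * 185\<^sup>2\<close> clears the denominators of the coordinates and of the real part \<open>-1/2\<close>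
  of the primitive cube roots of unity.
\<close>

definition mu3_gram :: "int \<times> nat \<times> int \<times> nat \<Rightarrow> int \<times> nat \<times> int \<times> nat \<Rightarrow> int" where
  "mu3_gram = (\<lambda>(p, i, q, j) (p', i', q', j').
     p * p' * (if i = i' then 2 else - 1) + q * q' * (if j = j' then 2 else - 1))"

text \<open>
  The four parts are the orbits of \<open>(1, 0)\<close>, \<open>(0, 1)\<close>, \<open>(-c, s)\<close>, \<open>(s, -c)\<close> under independent
  multiplication of the two complex coordinates by cube roots of unity. In the first two
  the index of the vanishing coordinate is fixed to 0, so that no point is listed twice.
\<close>

definition mu3_list :: "(int \<times> nat \<times> int \<times> nat) list" where
  "mu3_list =
     [(185, i, 0, 0). i \<leftarrow> [0, 1, 2]] @ [(0, 0, 185, j). j \<leftarrow> [0, 1, 2]] @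
     [(p, i, q, j). (p, q) \<leftarrow> [(-153, 104), (104, -153)], i \<leftarrow> [0, 1, 2], j \<leftarrow> [0, 1, 2]]"

lemma cube_root_inner:
  fixes i j :: nat
  assumes "i < 3" "j < 3"
  shows "cos (2 * pi * i / 3) * cos (2 * pi * j / 3) + sin (2 * pi * i / 3) * sin (2 * pi * j / 3) =
         (if i = j then 1 else - 1 / 2)"
proof -
  have a: "cos (2 * pi / 3) = - 1 / 2" "cos (4 * pi / 3) = - 1 / 2" 
          "sin (2 * pi / 3) = sqrt 3 / 2" "sin (4 * pi / 3) = - sqrt 3 / 2"
    using cos_120 sin_120 cos_periodic_pi2[of "pi/3"] sin_periodic_pi2[of "pi/3"]
    by (auto simp: cos_60 sin_60 field_simps)
  have "i = 0 \<or> i = 1 \<or> i = 2" "j = 0 \<or> j = 1 \<or> j = 2" using assms by auto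
  then show ?thesis by (elim disjE) (simp_all add: a)
qed

lemma mu3_list_range: "\<forall>(p, i, q, j)\<in>set mu3_list. i < 3 \<and> j < 3"
  by code_simp

lemma mu3_inner:
  assumes "x \<in> set mu3_list" "y \<in> set mu3_list"
  shows "mu3_point x \<bullet> mu3_point y = of_int (mu3_gram x y) / of_int 68450"
proof -
  obtain p i q j p' i' q' j' where xy: "x = (p, i, q, j)" "y = (p', i', q', j')"
    by (metis prod_cases4)
  define R where "R = (\<lambda>(i :: nat) (j :: nat). cos (2 * pi * i / 3) * cos (2 * pi * j / 3) +
    sin (2 * pi * i / 3) * sin (2 * pi * j / 3))"
  have "mu3_point x \<bullet> mu3_point y = (p * p' * R i i' + q * q' * R j j') / 185\<^sup>2"
    by (simp add: xy mu3_point_def inner_vec_def sum_4 vector_4 R_def field_simps)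
  moreover have "i < 3" "j < 3" "i' < 3" "j' < 3"
    using assms mu3_list_range unfolding xy by fast+
  then have "R i i' = (if i = i' then 1 else - 1 / 2)" "R j j' = (if j = j' then 1 else - 1 / 2)"
    unfolding R_def by (simp_all only: cube_root_inner)
  ultimately show ?thesis
    by (cases "i = i'"; cases "j = j'") (auto simp: xy mu3_gram_def field_simps)
qed

lemma mu3_list_distinct: "distinct mu3_list"
  by code_simp

lemma mu3_list_unit:
  "\<forall>x\<in>set mu3_list. \<forall>y\<in>set mu3_list. mu3_gram x y = 68450 \<longleftrightarrow> x = y"
  by code_simp

text \<open>
  The bound 11210 is a round number between the energies of the two codes.
\<close>

lemma mu3_sum:
  "(\<Sum>x\<leftarrow>mu3_list. \<Sum>y\<leftarrow>mu3_list. if x = y then 0 else (68450 + mu3_gram x y) ^ 10)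
     < 11210 * 68450 ^ 10"
  by code_simp

lemma mu3_list_length: "length mu3_list = 24"
  by code_simp

theorem mainTheorem1:
  shows "\<not> universally_optimal D4_code"
proof
  assume "universally_optimal D4_code"
  let ?C = "mu3_point ` set mu3_list" and ?f = "\<lambda>t::real. (1 + t) ^ 10"
  note C = integer_gram[of mu3_list 68450 mu3_point mu3_gram,
      OF mu3_list_distinct _ mu3_inner mu3_list_unit]
  have "?C \<subseteq> sphere 0 1" "card ?C = card D4_code"
    using C(1,2) by (simp_all add: mu3_list_length card_D4_code)
  with \<open>universally_optimal D4_code\<close> have "energy ?f D4_code \<le> energy ?f ?C"
    by (auto simp: universally_optimal_def absolutely_monotonic_power)
  moreover have "energy ?f ?C < 11210"
  proof -
    have "real_of_int (\<Sum>x\<leftarrow>mu3_list. \<Sum>y\<leftarrow>mu3_list.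
        if x = y then 0 else (68450 + mu3_gram x y) ^ 10) < of_int (11210 * 68450 ^ 10)"
      using mu3_sum by (subst of_int_less_iff)
    then show ?thesis using C(3)[of 10] by (simp add: field_simps)
  qed
  ultimately show False by (simp add: energy_D4)
qed

end
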